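(* Let $P$ be a finite set of primes with $2\in P$. Let $(\delta; w_0,w_1,w_\infty)$ run over all triples in which $\delta\in P^*$ is a square-free integer and $w_0,w_1,w_\infty\in T_{\infty,2,\infty}(\mathbb{Z}^P)^\delta\cup\{1\}$ satisfy \[ \Delta(w_0,w_1,w_\infty) = -4\,w_0w_1w_\infty . \] Then the polynomials \[ S(w_0,w_1,w_\infty)=\frac{1}{w_\infty}\,s(w_0,w_1,w_\infty;t) \] have discriminant class $\delta$ (i.e. their discriminant equals $\delta$ modulo $(\mathbb{Q}^\times)^2$), and they run over $\mathrm{MPolys}_{[2]}(P)$.
   Context: For a finite set of primes $P=\{p_1,\dots,p_r\}$, $P^*$ denotes the set of integers $\pm p_1^{e_1}\cdots p_r^{e_r}$ with $e_i\ge 0$, and $\mathbb{Z}^P$ denotes the ring of rational numbers whose denominators lie in $P^*$; $\mathbb{Z}^{P\times}$ is its unit group. A polynomial in $\mathbb{Z}[t]$ is normalized if its leading coefficient $s(\infty)$ is positive and the gcd of its coefficients is $1$. For a partition $\kappa$, $\mathrm{Polys}_\kappa(P)$ is the set of normalized $s(t)\in\mathbb{Z}[t]$ such that the degrees of the irreducible factors of $s$ form the partition $\kappa$, and $\mathrm{Disc}(s)$, $s(0)$, $s(1)$, $s(\infty)$ all lie in $P^*$. Set $\mathrm{Polys}_{[2]}(P)=\mathrm{Polys}_{2}(P)\sqcup\mathrm{Polys}_{1^2}(P)$, and $\mathrm{MPolys}_{[2]}(P)=\{s(t)/s(\infty): s\in \mathrm{Polys}_{[2]}(P)\}$ (monic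 polynomials in $\mathbb{Z}^P[t]$). For a rational $w\ne 0,1$, write $w=-A/C$ with $A,B,C$ the unique pairwise coprime integers with $A+B+C=0$ and $ABC<0$. $T_{\infty,2,\infty}(\mathbb{Z}^P)$ is the set of such $w$ with $A,C\in P^*$ and $B=by^2$ for some $b\in P^*$ and integer $y$. The discriminant class of $w$ is $w(1-w)\in\mathbb{Q}^\times/\mathbb{Q}^{\times2}$, and $T_{\infty,2,\infty}(\mathbb{Z}^P)^\delta$ is the set of those $w$ with discriminant class $\delta$. For $(u_0,u_1,u_\infty)\in\mathbb{Q}^3$, $s(u_0,u_1,u_\infty;t)=u_\infty t^2+(u_1-u_0-u_\infty)t+u_0$ and $\Delta(u_0,u_1,u_\infty)=(u_1-u_0-u_\infty)^2-4u_0u_\infty=(u_0^2+u_1^2+u_\infty^2)-2(u_0u_1+u_0u_\infty+u_1u_\infty)$.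
   Formalization: The formal theorem says the polynomials have discriminant class −δ, not δ: with the class of w taken as w(1−w), the stated sign is wrong, e.g. δ=1, (w_0,w_1,w_∞)=(1,1/2,1/2) gives t²−2t+2 of discriminant −4. *)

theory Defs
  imports
    "HOL-Computational_Algebra.Polynomial_Factorial"
    "HOL-Computational_Algebra.Squarefree"
    "Subresultants.Resultant_Prelim"
begin

definition Pstar :: "nat set \<Rightarrow> int set" where
  "Pstar P = {\<sigma> * (\<Prod>p\<in>P. int p ^ e p) | \<sigma> e. \<sigma> \<in> {1, - 1}}"

definition disc :: "'a::{idom_divide} poly \<Rightarrow> 'a" where
  "disc s = (let n = degree s in
     (- 1) ^ (n * (n - 1) div 2) * (resultant s (pderiv s) div lead_coeff s))"

text \<open>For a primitive polynomial the prime factors in \<open>\<int>[t]\<close> are the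
  irreducible factors over \<open>\<rat>\<close>, each of positive degree.\<close>

definition Polys :: "nat multiset \<Rightarrow> nat set \<Rightarrow> int poly set" where
  "Polys \<kappa> P = {s. lead_coeff s > 0 \<and> content s = 1 \<and>
     image_mset degree (prime_factorization s) = \<kappa> \<and>
     disc s \<in> Pstar P \<and> poly s 0 \<in> Pstar P \<and> poly s 1 \<in> Pstar P \<and>
     lead_coeff s \<in> Pstar P}"

definition Polys2 :: "nat set \<Rightarrow> int poly set" where
  "Polys2 P = Polys {#2#} P \<union> Polys {#1, 1#} P"

definition MPolys2 :: "nat set \<Rightarrow> rat poly set" where
  "MPolys2 P = {smult (1 / of_int (lead_coeff s)) (map_poly of_int s) | s. s \<in> Polys2 P}"

text \<open>The triple \<open>(A, B, C)\<close> is determined by \<open>w\<close>: coprimality fixes it up to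
  a common sign, and \<open>A * B * C < 0\<close> fixes the sign.\<close>

definition T_inf_2_inf :: "nat set \<Rightarrow> rat set" where
  "T_inf_2_inf P = {w. w \<noteq> 0 \<and> w \<noteq> 1 \<and>
     (\<exists>A B C. coprime A B \<and> coprime A C \<and> coprime B C \<and> A + B + C = 0 \<and> A * B * C < 0 \<and>
        w = - of_int A / of_int C \<and> A \<in> Pstar P \<and> C \<in> Pstar P \<and>
        (\<exists>b\<in>Pstar P. \<exists>y. B = b * y ^ 2))}"

text \<open>The coset of \<open>x\<close> in \<open>\<rat>\<^sup>\<times> / \<rat>\<^sup>\<times>\<^sup>2\<close>, for \<open>x \<noteq> 0\<close>.\<close>

definition sq_class :: "rat \<Rightarrow> rat set" where
  "sq_class x = {x * q ^ 2 | q. q \<noteq> 0}"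

definition disc_class :: "rat \<Rightarrow> rat set" where
  "disc_class w = sq_class (w * (1 - w))"

definition T_inf_2_inf_class :: "nat set \<Rightarrow> int \<Rightarrow> rat set" where
  "T_inf_2_inf_class P \<delta> = {w \<in> T_inf_2_inf P. disc_class w = sq_class (of_int \<delta>)}"

definition spoly :: "rat \<Rightarrow> rat \<Rightarrow> rat \<Rightarrow> rat poly" where
  "spoly u0 u1 uinf = [:u0, u1 - u0 - uinf, uinf:]"

definition Delta :: "rat \<Rightarrow> rat \<Rightarrow> rat \<Rightarrow> rat" where
  "Delta u0 u1 uinf = (u1 - u0 - uinf) ^ 2 - 4 * u0 * uinf"

definition Spoly :: "rat \<Rightarrow> rat \<Rightarrow> rat \<Rightarrow> rat poly" where
  "Spoly w0 w1 winf = smult (1 / winf) (spoly w0 w1 winf)"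

definition admissible :: "nat set \<Rightarrow> int \<Rightarrow> rat \<Rightarrow> rat \<Rightarrow> rat \<Rightarrow> bool" where
  "admissible P \<delta> w0 w1 winf \<longleftrightarrow> \<delta> \<in> Pstar P \<and> squarefree \<delta> \<and>
     w0 \<in> T_inf_2_inf_class P \<delta> \<union> {1} \<and>
     w1 \<in> T_inf_2_inf_class P \<delta> \<union> {1} \<and>
     winf \<in> T_inf_2_inf_class P \<delta> \<union> {1} \<and>
     Delta w0 w1 winf = - 4 * w0 * w1 * winf"

lemma det_2x2:
  assumes "A \<in> carrier_mat 2 2"
  shows "det A = A $$ (0, 0) * A $$ (1, 1) - A $$ (0, 1) * A $$ (1, 0)"
  using assms
  by (subst laplace_expansion_column[OF assms, of 0])
     (auto simp: cofactor_def mat_delete_def det_single numeral_2_eq_2 algebra_simps)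

lemma det_3x3:
  assumes "A \<in> carrier_mat 3 3"
  shows "det A = A $$ (0, 0) * (A $$ (1, 1) * A $$ (2, 2) - A $$ (1, 2) * A $$ (2, 1))
    - A $$ (1, 0) * (A $$ (0, 1) * A $$ (2, 2) - A $$ (0, 2) * A $$ (2, 1))
    + A $$ (2, 0) * (A $$ (0, 1) * A $$ (1, 2) - A $$ (0, 2) * A $$ (1, 1))"
proof -
  have "mat_delete A i 0 \<in> carrier_mat 2 2" for i
    using assms by (auto simp: mat_delete_def)
  note d = det_2x2[OF this]
  have "det A = A $$ (0, 0) * det (mat_delete A 0 0) - A $$ (1, 0) * det (mat_delete A 1 0)
    + A $$ (2, 0) * det (mat_delete A 2 0)"
    by (subst laplace_expansion_column[OF assms, of 0])
       (auto simp: cofactor_def numeral_3_eq_3 numeral_2_eq_2)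
  then show ?thesis
    unfolding d using assms by (simp add: mat_delete_def numeral_2_eq_2)
qed

lemma disc_quadratic:
  fixes a b c :: "'a::{idom_divide, ring_char_0}"
  assumes "a \<noteq> 0"
  shows "disc [:c, b, a:] = b ^ 2 - 4 * a * c"
proof -
  have d: "pderiv [:c, b, a:] = [:b, 2 * a:]"
    by (simp add: pderiv_pCons)
  have "resultant [:c, b, a:] [:b, 2 * a:] = a * (4 * a * c - b ^ 2)"
  proof -
    have "sylvester_mat [:c, b, a:] [:b, 2 * a:] \<in> carrier_mat 3 3"
      using assms by (auto simp: sylvester_mat_def sylvester_mat_sub_def)
    then show ?thesis
      unfolding resultant_def using assms
      by (subst det_3x3)
         (auto simp: sylvester_mat_def sylvester_mat_sub_def numeral_2_eq_2 algebra_simps)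
  qed
  then show ?thesis
    using assms by (simp add: disc_def d)
qed

text \<open>
  A sign to watch. For an admissible triple with \<open>w0 \<noteq> 1\<close>, \<open>Delta w0 w1 winf + 4 * w1 * winf\<close> is the square of
  \<open>w0 - w1 - winf\<close>. Together with \<open>Delta w0 w1 winf = - 4 * w0 * w1 * winf\<close> this puts
  \<open>w0 * (1 - w0)\<close> in the class of \<open>w0 * w1 * winf\<close>, which is the class of
  \<open>- disc (Spoly w0 w1 winf)\<close>. So with the class of \<open>w\<close> defined by \<open>w * (1 - w)\<close>, the polynomials
  have class \<open>- \<delta>\<close>, and the class \<open>\<delta>\<close> belongs to the normalisation \<open>w * (w - 1)\<close>.
  For example, \<open>(1, 1/2, 1/2)\<close> is admissible for \<open>\<delta> = 1\<close> and gives
  \<open>t\<^sup>2 - 2 * t + 2\<close>, of discriminant \<open>- 4\<close>.\<close>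

lemma sign_example:
  assumes "finite P" "2 \<in> P"
  shows "admissible P 1 1 (1/2) (1/2)"
    and "Spoly 1 (1/2) (1/2) = [:2, - 2, 1:]"
    and "sq_class (disc (Spoly 1 (1/2) (1/2))) \<noteq> sq_class (of_int 1)"
proof -
  have one: "1 \<in> Pstar P"
    unfolding Pstar_def by (rule CollectI, rule exI[of _ 1], rule exI[of _ "\<lambda>_. 0"]) simp
  have two: "- 2 \<in> Pstar P"
    unfolding Pstar_def
  proof (rule CollectI, rule exI[of _ "- 1"], rule exI[of _ "\<lambda>p. if p = 2 then 1 else 0"])
    have "(\<Prod>p\<in>P. int p ^ (if p = 2 then 1 else 0)) = (\<Prod>p\<in>P. if p = 2 then 2 else 1)"
      by (rule prod.cong) auto
    also have "\<dots> = 2"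
      using assms by (subst prod.delta) auto
    finally show "- 2 = - 1 * (\<Prod>p\<in>P. int p ^ (if p = 2 then 1 else 0)) \<and> - 1 \<in> {1, - 1::int}"
      by simp
  qed
  have "(1/2 :: rat) \<in> T_inf_2_inf P"
    unfolding T_inf_2_inf_def
  proof (intro CollectI conjI)
    show "\<exists>A B C. coprime A B \<and> coprime A C \<and> coprime B C \<and> A + B + C = 0 \<and> A * B * C < 0 \<and>
        1/2 = - rat_of_int A / rat_of_int C \<and> A \<in> Pstar P \<and> C \<in> Pstar P \<and>
        (\<exists>b\<in>Pstar P. \<exists>y. B = b * y ^ 2)"
      by (rule exI[of _ 1], rule exI[of _ 1], rule exI[of _ "- 2"])
        (use one two in \<open>auto intro!: bexI[of _ 1] exI[of _ 1]\<close>)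
  qed auto
  moreover have "disc_class (1/2) = sq_class (of_int 1)"
  proof -
    have "\<exists>r. 1/2 * (1 - 1/2) * q\<^sup>2 = of_int 1 * r\<^sup>2 \<and> r \<noteq> 0" if "q \<noteq> 0" for q :: rat
      using that by (intro exI[of _ "q / 2"]) (simp add: power2_eq_square)
    moreover have "\<exists>r. of_int 1 * q\<^sup>2 = 1/2 * (1 - 1/2) * r\<^sup>2 \<and> r \<noteq> 0" if "q \<noteq> 0" for q :: rat
      using that by (intro exI[of _ "q * 2"]) (simp add: power2_eq_square)
    ultimately show ?thesis
      unfolding disc_class_def sq_class_def by blast
  qed
  ultimately have "1/2 \<in> T_inf_2_inf_class P 1"
    by (simp add: T_inf_2_inf_class_def)
  then show "admissible P 1 1 (1/2) (1/2)"
    using one by (simp add: admissible_def Delta_def)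
  show S: "Spoly 1 (1/2) (1/2) = [:2, - 2, 1:]"
    by (simp add: Spoly_def spoly_def)
  have "- 4 \<in> sq_class (- 4)"
    unfolding sq_class_def by (auto intro!: exI[of _ 1])
  moreover have "- 4 \<notin> sq_class (of_int 1)"
  proof
    assume "- 4 \<in> sq_class (of_int 1)"
    then obtain q :: rat where "- 4 = q ^ 2"
      by (auto simp: sq_class_def)
    then show False
      using zero_le_power2[of q] by linarith
  qed
  ultimately show "sq_class (disc (Spoly 1 (1/2) (1/2))) \<noteq> sq_class (of_int 1)"
    unfolding S by (auto simp: disc_quadratic)
qed

end

theory Submission
  imports Defs
begin

text \<open>For admissible triples the identity \<open>Delta w0 w1 winf + 4 * w1 * winf = (w0 - w1 - winf)\<^sup>2\<close>
  shows that \<open>w0 * w1 * winf\<close>, hence \<open>- disc (Spoly w0 w1 winf)\<close>, has the class of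
  \<open>w0 * (1 - w0)\<close>. Conversely, an integral quadratic \<open>s\<close> with coefficients \<open>(c, b, a)\<close>,
  \<open>e = s(1)\<close> and discriminant \<open>D\<close> comes from the triple
  \<open>- D / (4 a e), - D / (4 a c), - D / (4 c e)\<close>; these lie in \<open>T_inf_2_inf\<close> because
  \<open>D + 4 a e = (2 a + b)\<^sup>2\<close>, \<open>D + 4 a c = b\<^sup>2\<close> and \<open>D + 4 c e = (2 c + b)\<^sup>2\<close>.\<close>

section \<open>Square classes and the discriminant class of admissible triples\<close>

lemma sq_class_mult_square:
  assumes "q \<noteq> 0"
  shows "sq_class (x * q ^ 2) = sq_class x"
proof (rule Set.set_eqI, rule iffI)
  fix z assume "z \<in> sq_class (x * q ^ 2)"
  then obtain r where "z = x * (q * r) ^ 2" "r \<noteq> 0"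
    by (auto simp: sq_class_def power_mult_distrib mult.assoc)
  then show "z \<in> sq_class x"
    using assms by (auto simp: sq_class_def)
next
  fix z assume "z \<in> sq_class x"
  then obtain r where "z = x * q ^ 2 * (r / q) ^ 2" "r \<noteq> 0"
    using assms by (auto simp: sq_class_def power_divide)
  moreover have "r / q \<noteq> 0"
    using calculation assms by simp
  ultimately show "z \<in> sq_class (x * q ^ 2)"
    unfolding sq_class_def by blast
qed

lemma sq_class_eqD:
  assumes "sq_class x = sq_class y"
  obtains q where "q \<noteq> 0" "x = y * q ^ 2"
proof -
  have "x \<in> sq_class x"
    by (auto simp: sq_class_def intro!: exI[of _ 1])
  then show ?thesis
    using that unfolding assms by (auto simp: sq_class_def)
qed

text \<open>Cyclic shifts move any of the three entries into first place, so a fact about the first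
  entry serves for all of them.\<close>

lemma Delta_rotate: "Delta a b c = Delta b c a"
  by (simp add: Delta_def power2_eq_square algebra_simps)

lemma disc_Spoly:
  assumes "c \<noteq> 0"
  shows "disc (Spoly a b c) = Delta a b c / c ^ 2"
proof -
  have "Spoly a b c = [:a / c, (b - a - c) / c, 1:]"
    using assms by (simp add: Spoly_def spoly_def)
  then show ?thesis
    using assms by (simp add: disc_quadratic Delta_def power2_eq_square field_simps)
qed

text \<open>The equation rearranges to \<open>(a - b - c) ^ 2 = 4 * b * c * (1 - a)\<close>, so
  \<open>1 - a\<close> and \<open>b * c\<close> differ by a square factor, which is nonzero because
  \<open>a \<noteq> 1\<close>.\<close>

lemma Delta_class:
  assumes "Delta a b c = - 4 * a * b * c" "a \<noteq> 0" "a \<noteq> 1" "b \<noteq> 0" "c \<noteq> 0"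
  shows "sq_class (a * b * c) = disc_class a"
proof -
  define r where "r = (a - b - c) / (2 * b * c)"
  have sq: "(a - b - c) ^ 2 = 4 * b * c * (1 - a)"
    using assms(1) by (simp add: Delta_def power2_eq_square algebra_simps)
  have "r \<noteq> 0"
    using sq assms by (auto simp: r_def)
  have "r ^ 2 = (1 - a) / (b * c)"
    unfolding r_def power_divide sq using assms by (simp add: power2_eq_square field_simps)
  then have "a * (1 - a) = (a * b * c) * r ^ 2"
    using assms by simp
  then show ?thesis
    unfolding disc_class_def using sq_class_mult_square[OF \<open>r \<noteq> 0\<close>] by metis
qed

lemma admissible_class:
  assumes "admissible P \<delta> a b c"
  shows "sq_class (a * b * c) = sq_class (of_int \<delta>)" and "a \<noteq> 0" "b \<noteq> 0" "c \<noteq> 0"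
proof -
  have D: "Delta a b c = - 4 * a * b * c"
    and T: "a \<in> T_inf_2_inf_class P \<delta> \<union> {1}" "b \<in> T_inf_2_inf_class P \<delta> \<union> {1}"
      "c \<in> T_inf_2_inf_class P \<delta> \<union> {1}"
    using assms by (auto simp: admissible_def)
  show nz: "a \<noteq> 0" "b \<noteq> 0" "c \<noteq> 0"
    using T by (auto simp: T_inf_2_inf_class_def T_inf_2_inf_def)
  have cls: "disc_class x = sq_class (of_int \<delta>)" if "x \<in> T_inf_2_inf_class P \<delta> \<union> {1}" "x \<noteq> 1" for x
    using that by (auto simp: T_inf_2_inf_class_def)
  \<comment> \<open>\<open>Delta 1 1 1\<close> is -3 while the right-hand side is -4, so some entry
    differs from 1 and carries the class \<delta>.\<close>
  have "\<not> (a = 1 \<and> b = 1 \<and> c = 1)"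
    using D by (auto simp: Delta_def)
  then consider "a \<noteq> 1" | "b \<noteq> 1" | "c \<noteq> 1"
    by blast
  then show "sq_class (a * b * c) = sq_class (of_int \<delta>)"
  proof cases
    case 1
    then show ?thesis
      using Delta_class[OF D] nz cls T by simp
  next
    case 2
    have "Delta b c a = - 4 * b * c * a"
      using D by (simp add: Delta_rotate[of a b c])
    from Delta_class[OF this] 2 show ?thesis
      using nz cls T by (simp add: mult_ac)
  next
    case 3
    have "Delta c a b = - 4 * c * a * b"
      using D by (simp add: Delta_rotate[of c a b])
    from Delta_class[OF this] 3 show ?thesis
      using nz cls T by (simp add: mult_ac)
  qed
qed

text \<open>The factor -4 in the equation is minus a square: this is where the sign in
  \<open>- \<delta>\<close> arises.\<close>

lemma disc_Spoly_class:
  assumes "admissible P \<delta> a b c"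
  shows "sq_class (disc (Spoly a b c)) = sq_class (of_int (- \<delta>))"
proof -
  note nz = admissible_class(2-4)[OF assms]
  obtain q where q: "q \<noteq> 0" "a * b * c = of_int \<delta> * q ^ 2"
    using sq_class_eqD[OF admissible_class(1)[OF assms]] .
  have "disc (Spoly a b c) = - 4 * (a * b * c) / c ^ 2"
    using assms nz by (simp add: disc_Spoly admissible_def mult.assoc)
  also have "\<dots> = of_int (- \<delta>) * (2 * q / c) ^ 2"
    unfolding q by (simp add: power_divide power_mult_distrib)
  finally show ?thesis
    using q nz by (simp add: sq_class_mult_square del: of_int_minus)
qed

section \<open>Factorization types of primitive integral quadratics\<close>

text \<open>The product of the prime factors is only associated to \<open>s\<close>; divisibility in
  both directions is enough to compare degrees.\<close>

lemma sum_degree_prime_factorization: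
  fixes s :: "int poly"
  assumes "s \<noteq> 0"
  shows "(\<Sum>q\<in>#prime_factorization s. degree q) = degree s"
proof -
  have deg: "degree (prod_mset M) = (\<Sum>q\<in>#M. degree q)" if "0 \<notin># M" for M :: "int poly multiset"
    using that by (induction M) (auto simp: degree_mult_eq prod_mset_zero_iff)
  have "normalize (prod_mset (prime_factorization s)) = normalize s"
    using assms by (rule prod_mset_prime_factorization_weak)
  then have "prod_mset (prime_factorization s) dvd s" "s dvd prod_mset (prime_factorization s)"
    by (simp_all only: associated_iff_dvd)
  then have "degree s = degree (prod_mset (prime_factorization s))"
    using assms by (intro antisym dvd_imp_degree_le) auto
  also have "\<dots> = (\<Sum>q\<in>#prime_factorization s. degree q)"
    by (rule deg) auto
  finally show ?thesis ..
qed

text \<open>A constant prime factor would divide the content, hence be a unit.\<close>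

lemma degree_prime_factor_pos:
  fixes s :: "int poly"
  assumes "content s = 1" "q \<in># prime_factorization s"
  shows "degree q > 0"
proof (rule ccontr)
  assume "\<not> degree q > 0"
  then obtain c where c: "q = [:c:]"
    using degree_eq_zeroE by blast
  have "prime q" "q dvd s"
    using assms(2) by (auto simp: in_prime_factors_iff)
  then have "c dvd 1"
    using assms(1) by (simp add: c const_poly_dvd_iff_dvd_content)
  then show False
    using \<open>prime q\<close> by (metis c is_unit_const_poly_iff not_prime_unit)
qed

lemma mset_nat_sum_2:
  fixes M :: "nat multiset"
  assumes "sum_mset M = 2" "\<And>x. x \<in># M \<Longrightarrow> x > 0"
  shows "M = {#2#} \<or> M = {#1, 1#}"
proof (cases M)
  case empty
  then show ?thesis using assms by simp
next
  case (add x N)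
  show ?thesis
  proof (cases N)
    case empty
    then show ?thesis using assms add by simp
  next
    case (add y K)
    with \<open>M = _\<close> assms have "x > 0" "y > 0" "x + y + sum_mset K = 2"
      by auto
    then have "x = 1" "y = 1" "sum_mset K = 0"
      by linarith+
    moreover have "z > 0" if "z \<in># K" for z
      using that assms(2) \<open>M = _\<close> add by auto
    ultimately have "K = {#}"
      by (metis multiset_nonemptyE sum_mset_0_iff less_irrefl)
    then show ?thesis
      using \<open>x = 1\<close> \<open>y = 1\<close> \<open>M = _\<close> add by simp
  qed
qed

text \<open>For primitive \<open>s\<close> the factor degrees are positive and sum to the degree,
  and 2 has only the partitions 2 and 1+1. Hence the two types together amount to degree 2, and
  factorizations can be ignored from here on.\<close>

lemma mem_Polys2_iff:
  "s \<in> Polys2 P \<longleftrightarrow> degree s = 2 \<and> lead_coeff s > 0 \<and> content s = 1 \<and>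
     disc s \<in> Pstar P \<and> poly s 0 \<in> Pstar P \<and> poly s 1 \<in> Pstar P \<and> lead_coeff s \<in> Pstar P"
proof -
  have "image_mset degree (prime_factorization s) \<in> {{#2#}, {#1, 1#}} \<longleftrightarrow> degree s = 2"
    if "content s = 1" "lead_coeff s > 0"
  proof -
    have "s \<noteq> 0"
      using that by auto
    note sum = sum_degree_prime_factorization[OF this]
    show ?thesis
    proof
      assume "image_mset degree (prime_factorization s) \<in> {{#2#}, {#1, 1#}}"
      then show "degree s = 2"
        by (auto simp flip: sum)
    next
      assume "degree s = 2"
      then show "image_mset degree (prime_factorization s) \<in> {{#2#}, {#1, 1#}}"
        using mset_nat_sum_2[of "image_mset degree (prime_factorization s)"]
          degree_prime_factor_pos[OF that(1)] sum by auto
    qed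
  qed
  then show ?thesis
    by (auto simp: Polys2_def Polys_def)
qed

lemma degree_2_coeffs:
  assumes "degree s = 2"
  shows "s = [:coeff s 0, coeff s 1, coeff s 2:]"
proof (rule poly_eqI)
  fix n :: nat
  consider "n = 0" | "n = 1" | "n = 2" | "n > 2"
    by linarith
  then show "coeff s n = coeff [:coeff s 0, coeff s 1, coeff s 2:] n"
    by cases (simp_all add: assms coeff_eq_0 coeff_pCons numeral_2_eq_2 split: nat.split)
qed

section \<open>Arithmetic of \<open>Pstar\<close>\<close>

context
  fixes P :: "nat set"
  assumes fin: "finite P" and primes: "\<forall>p\<in>P. prime p"
begin

text \<open>Describing membership by prime support removes the exponent functions; closure under
  products and divisors then follows from properties of \<open>prime_factors\<close>.\<close>

lemma Pstar_iff: "x \<in> Pstar P \<longleftrightarrow> x \<noteq> 0 \<and> prime_factors x \<subseteq> int ` P"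
proof
  assume "x \<in> Pstar P"
  then obtain \<sigma> e where x: "x = \<sigma> * (\<Prod>p\<in>P. int p ^ e p)" and \<sigma>: "\<sigma> \<in> {1, -1}"
    by (auto simp: Pstar_def)
  have "x \<noteq> 0"
    using x \<sigma> fin primes by (auto simp: not_prime_0)
  moreover have "q \<in> int ` P" if "q \<in> prime_factors x" for q
  proof -
    have q: "prime q" "q dvd x"
      using that by (auto simp: in_prime_factors_iff)
    then have "q dvd (\<Prod>p\<in>P. int p ^ e p)"
      using x \<sigma> by auto
    then obtain p where p: "p \<in> P" "q dvd int p ^ e p"
      using q(1) fin by (auto simp: prime_dvd_prod_iff)
    then have "q dvd int p"
      using q(1) prime_dvd_power by blast
    then have "q = int p"
      using q(1) p(1) primes by (metis prime_nat_int_transfer primes_dvd_imp_eq)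
    then show ?thesis
      using p by blast
  qed
  ultimately show "x \<noteq> 0 \<and> prime_factors x \<subseteq> int ` P"
    by blast
next
  assume x: "x \<noteq> 0 \<and> prime_factors x \<subseteq> int ` P"
  have "(\<Prod>p\<in>P. int p ^ multiplicity (int p) x) = (\<Prod>p\<in>int ` P. p ^ multiplicity p x)"
    by (subst prod.reindex) (auto simp: inj_on_def)
  \<comment> \<open>Primes of \<open>P\<close> that do not divide \<open>x\<close> have multiplicity
    0 and contribute a factor 1.\<close>
  also have "\<dots> = (\<Prod>p\<in>prime_factors x. p ^ multiplicity p x)"
    using x fin primes
    by (intro prod.mono_neutral_right)
       (auto simp: in_prime_factors_iff not_dvd_imp_multiplicity_0)
  also have "\<dots> = normalize x"
    using x by (simp add: prod_prime_factors)
  finally have "x = sgn x * (\<Prod>p\<in>P. int p ^ multiplicity (int p) x)"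
    by (simp add: sgn_mult_abs)
  moreover have "sgn x \<in> {1, -1}"
    using x by (auto simp: sgn_if)
  ultimately show "x \<in> Pstar P"
    unfolding Pstar_def
    by (intro CollectI exI[of _ "sgn x"] exI[of _ "\<lambda>p. multiplicity (int p) x"] conjI)
qed

lemma Pstar_nonzero: "x \<in> Pstar P \<Longrightarrow> x \<noteq> 0"
  by (simp add: Pstar_iff)

lemma Pstar_mult: "x \<in> Pstar P \<Longrightarrow> y \<in> Pstar P \<Longrightarrow> x * y \<in> Pstar P"
  by (auto simp: Pstar_iff prime_factors_product)

lemma Pstar_dvd: "x \<in> Pstar P \<Longrightarrow> y dvd x \<Longrightarrow> y \<in> Pstar P"
  using dvd_prime_factors[of x y] by (auto simp: Pstar_iff)

lemma Pstar_one: "1 \<in> Pstar P"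
  by (simp add: Pstar_iff)

lemma Pstar_uminus: "- x \<in> Pstar P \<longleftrightarrow> x \<in> Pstar P"
  by (simp add: Pstar_iff)

lemma Pstar_two: "2 \<in> P \<Longrightarrow> 2 \<in> Pstar P"
  by (auto simp: Pstar_iff prime_factorization_prime)

text \<open>A prime of the squarefree part has odd exponent in \<open>x\<close>. The exponents in
  \<open>g\<close> and \<open>x\<close> sum to an even number, so that prime divides
  \<open>g\<close> as well.\<close>

lemma Pstar_squarefree_part:
  assumes "g \<in> Pstar P" "g * x = y ^ 2" "y \<noteq> 0"
  shows "squarefree_part x \<in> Pstar P"
proof -
  have nz: "g \<noteq> 0" "x \<noteq> 0"
    using assms by auto
  have "q \<in> prime_factors g" if "q \<in> prime_factors (squarefree_part x)" for q
  proof -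
    have q: "prime q" "q dvd squarefree_part x"
      using that by (auto simp: in_prime_factors_iff)
    then have "multiplicity q (squarefree_part x) \<noteq> 0"
      using multiplicity_gt_zero_iff[of "squarefree_part x" q] not_prime_unit[of q] by auto
    then have "odd (multiplicity q x)"
      using q(1) by (simp add: prime_multiplicity_squarefree_part odd_iff_mod_2_eq_one)
    moreover have "multiplicity q g + multiplicity q x = multiplicity q (y ^ 2)"
      unfolding assms(2)[symmetric] using q(1) nz
      by (subst prime_elem_multiplicity_mult_distrib) auto
    then have "multiplicity q g + multiplicity q x = 2 * multiplicity q y"
      using q(1) assms(3) by (subst (asm) prime_elem_multiplicity_power_distrib) auto
    ultimately have "multiplicity q g \<noteq> 0"
      by presburger
    then have "q dvd g"
      by (metis not_dvd_imp_multiplicity_0)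
    then show ?thesis
      using q(1) nz by (auto simp: in_prime_factors_iff)
  qed
  then show ?thesis
    using assms(1) by (auto simp: Pstar_iff)
qed

section \<open>Criteria for membership in \<open>T_inf_2_inf\<close> and its classes\<close>

text \<open>Dividing \<open>m\<close>, \<open>n\<close> and \<open>- (m + n)\<close> by a signed gcd
  \<open>g\<close> gives the coprime triple. The middle entry \<open>B\<close> satisfies
  \<open>- g * B = y ^ 2\<close>, so its squarefree part involves only primes of \<open>g\<close>,
  which lie in \<open>P\<close>.\<close>

lemma T_inf_2_inf_I:
  assumes m: "m \<in> Pstar P" and n: "n \<in> Pstar P" and y: "m + n = y ^ 2" "y \<noteq> 0"
  shows "- of_int m / of_int n \<in> T_inf_2_inf P"
proof -
  \<comment> \<open>The sign is that of \<open>m * n\<close>, hence of \<open>A * C\<close>. As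
    \<open>g * (A + C)\<close> is a positive square, \<open>A + C\<close> has this sign too, which
    makes \<open>A * B * C\<close> negative for \<open>B = - (A + C)\<close>.\<close>
  define g where "g = sgn (m * n) * gcd m n"
  have nz: "m \<noteq> 0" "n \<noteq> 0"
    using m n by (auto simp: Pstar_nonzero)
  have gnz: "g \<noteq> 0"
    using nz by (simp add: g_def sgn_0_0)
  have "g dvd m" "g dvd n"
    using nz by (auto simp: g_def sgn_if)
  then obtain A C where A: "m = g * A" and C: "n = g * C"
    by (elim dvdE)
  have "gcd m n = \<bar>g\<bar>"
    using nz by (simp add: g_def abs_mult sgn_if)
  then have "\<bar>g\<bar> * gcd A C = \<bar>g\<bar>"
    by (simp add: A C gcd_mult_left abs_mult)
  then have AC: "coprime A C"
    using gnz by (simp add: coprime_iff_gcd_eq_1)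
  have gy: "g * (A + C) = y ^ 2"
    using y by (simp add: A C distrib_left)
  have "g * (A * C) > 0"
  proof -
    have "g * (m * n) = \<bar>m * n\<bar> * gcd m n"
      by (simp add: g_def abs_sgn mult_ac)
    then have "g * (A * C) * g ^ 2 > 0"
      using nz by (simp add: A C power2_eq_square mult_ac)
    then show ?thesis
      using gnz by (simp add: zero_less_mult_iff)
  qed
  moreover have "g * (A + C) > 0"
    unfolding gy using y by simp
  ultimately have "(g * (A * C)) * (g * (A + C)) > 0"
    by simp
  then have "g ^ 2 * (A * C * (A + C)) > 0"
    by (simp add: power2_eq_square mult_ac)
  then have neg: "A * (- (A + C)) * C < 0"
    using gnz by (simp add: zero_less_mult_iff mult_less_0_iff) (auto simp: mult_ac)
  have gP: "g \<in> Pstar P"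
    using Pstar_dvd[OF m \<open>g dvd m\<close>] .
  define b where "b = - squarefree_part (A + C)"
  have "b \<in> Pstar P"
    using Pstar_squarefree_part[OF gP gy y(2)] by (simp add: b_def Pstar_uminus)
  moreover have "- (A + C) = b * square_part (A + C) ^ 2"
    unfolding b_def using squarefree_decompose[of "A + C"] by simp
  ultimately have B: "\<exists>b\<in>Pstar P. \<exists>z. - (A + C) = b * z ^ 2"
    by blast
  have AP: "A \<in> Pstar P" and CP: "C \<in> Pstar P"
    using Pstar_dvd m n A C by auto
  have w: "- of_int m / of_int n = (- of_int A / of_int C :: rat)"
    using gnz by (simp add: A C)
  have cop: "coprime A (- (A + C))" "coprime (- (A + C)) C"
    using AC by (metis coprime_minus_right_iff gcd_add2 coprime_iff_gcd_eq_1)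
      (metis AC coprime_minus_left_iff gcd_add1 coprime_iff_gcd_eq_1)
  have "of_int m / of_int n \<noteq> (0::rat)"
    using nz by simp
  moreover have "- of_int m / of_int n \<noteq> (1::rat)"
  proof
    assume "- of_int m / of_int n = (1::rat)"
    then have "of_int (m + n) = (0::rat)"
      using nz by (simp add: field_simps)
    then show False
      using y by (simp del: of_int_add)
  qed
  ultimately show ?thesis
    unfolding T_inf_2_inf_def mem_Collect_eq
    using cop AC neg B AP CP w by (intro conjI exI[of _ A] exI[of _ "- (A + C)"] exI[of _ C]) auto
qed

text \<open>Here \<open>w = - m / n\<close> has \<open>1 - w = y ^ 2 / n\<close>, so
  \<open>w * (1 - w)\<close> is \<delta> times the square of \<open>z * y / n\<close>. The
  degenerate case \<open>y = 0\<close> gives \<open>w = 1\<close>, the extra element of the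
  union.\<close>

lemma T_inf_2_inf_class_I:
  assumes "m \<in> Pstar P" "n \<in> Pstar P" "m + n = y ^ 2" "m = - \<delta> * z ^ 2"
  shows "- of_int m / of_int n \<in> T_inf_2_inf_class P \<delta> \<union> {1}"
proof (cases "y = 0")
  case True
  then have "m = - n" "n \<noteq> 0"
    using assms(2,3) Pstar_nonzero[of n] by auto
  then show ?thesis
    by simp
next
  case False
  define w :: rat where "w = - of_int m / of_int n"
  have nz: "z \<noteq> 0" "n \<noteq> 0"
    using Pstar_nonzero[OF assms(1)] Pstar_nonzero[OF assms(2)] assms(4) by auto
  have sum: "of_int m + of_int n = (of_int y ^ 2 :: rat)"
    using arg_cong[OF assms(3), of rat_of_int] by simp
  have "1 - w = of_int y ^ 2 / of_int n"
    using nz unfolding sum[symmetric] by (simp add: w_def field_simps)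
  then have "w * (1 - w) = of_int \<delta> * (of_int (z * y) / of_int n) ^ 2"
    by (simp add: w_def assms(4) power2_eq_square)
  then have "disc_class w = sq_class (of_int \<delta>)"
    unfolding disc_class_def using nz False by (simp add: sq_class_mult_square)
  then show ?thesis
    using T_inf_2_inf_I[OF assms(1-3) False] by (simp add: T_inf_2_inf_class_def w_def)
qed

section \<open>The correspondence between admissible triples and quadratics\<close>

text \<open>Clearing denominators and removing the content gives a primitive \<open>s\<close> whose
  values at 0, 1 and infinity divide the elements \<open>u0\<close>, \<open>u1\<close>,
  \<open>u\<close> of \<open>Pstar P\<close>. The equation then makes the discriminant a divisor of
  an element of \<open>Pstar P\<close>.\<close>

lemma Spoly_in_MPolys2:
  assumes two: "2 \<in> P" and adm: "admissible P \<delta> w0 w1 winf"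
  shows "Spoly w0 w1 winf \<in> MPolys2 P"
proof -
  have "\<exists>a b. w = of_int a / of_int b \<and> a \<in> Pstar P \<and> b \<in> Pstar P"
    if w: "w \<in> T_inf_2_inf_class P \<delta> \<union> {1}" for w :: rat
  proof (cases "w = 1")
    case True
    then show ?thesis
      using Pstar_one by (intro exI[of _ 1]) auto
  next
    case False
    then obtain A C where "w = - of_int A / of_int C" "A \<in> Pstar P" "C \<in> Pstar P"
      using w False unfolding T_inf_2_inf_class_def T_inf_2_inf_def Un_iff mem_Collect_eq by fast
    then show ?thesis
      by (intro exI[of _ "- A"] exI[of _ C]) (simp add: Pstar_uminus)
  qed
  then obtain a0 b0 a1 b1 c d where
      w: "w0 = of_int a0 / of_int b0" "w1 = of_int a1 / of_int b1" "winf = of_int c / of_int d"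
      and un: "a0 \<in> Pstar P" "b0 \<in> Pstar P" "a1 \<in> Pstar P" "b1 \<in> Pstar P" "c \<in> Pstar P" "d \<in> Pstar P"
    using adm unfolding admissible_def by metis
  note nz = un[THEN Pstar_nonzero]
  define k where "k = b0 * b1 * d"
  define u0 u1 u where "u0 = a0 * b1 * d" and "u1 = a1 * b0 * d" and "u = c * b0 * b1"
  have un': "u0 \<in> Pstar P" "u1 \<in> Pstar P" "u \<in> Pstar P" "k \<in> Pstar P"
    unfolding u0_def u1_def u_def k_def by (intro Pstar_mult un)+
  then have nz': "u0 \<noteq> 0" "u1 \<noteq> 0" "u \<noteq> 0" "k \<noteq> 0"
    by (auto dest: Pstar_nonzero)
  have kw: "w0 = of_int u0 / of_int k" "w1 = of_int u1 / of_int k" "winf = of_int u / of_int k"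
    unfolding w u0_def u1_def u_def k_def using nz by simp_all
  define s' where "s' = [:u0, u1 - u0 - u, u:]"
  \<comment> \<open>Including the sign of \<open>u\<close> in the scalar makes the leading
    coefficient of \<open>s\<close> positive.\<close>
  define g where "g = sgn u * content s'"
  have "s' \<noteq> 0"
    using nz' by (simp add: s'_def)
  then have gnz: "g \<noteq> 0"
    using nz' by (simp add: g_def sgn_0_0)
  define s where "s = smult (sgn u) (primitive_part s')"
  have s': "s' = smult g s"
    using nz' by (simp add: s_def g_def sgn_if)
  define x y z where "x = coeff s 0" and "y = coeff s 1" and "z = coeff s 2"
  have xyz: "u0 = g * x" "u1 - u0 - u = g * y" "u = g * z"
    using arg_cong[OF s', of "\<lambda>p. coeff p 0"] arg_cong[OF s', of "\<lambda>p. coeff p 1"]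
      arg_cong[OF s', of "\<lambda>p. coeff p 2"]
    by (simp_all add: s'_def x_def y_def z_def numeral_2_eq_2)
  have u1: "u1 = g * (x + y + z)"
    using xyz by (simp add: algebra_simps)
  have znz: "z \<noteq> 0"
    using xyz nz' by auto
  have "degree s = degree s'"
    using gnz s' by simp
  then have deg: "degree s = 2"
    using nz' by (simp add: s'_def)
  then have s: "s = [:x, y, z:]"
    using degree_2_coeffs unfolding x_def y_def z_def by blast
  have D: "(u1 - u0 - u) ^ 2 - 4 * u0 * u = g ^ 2 * (y ^ 2 - 4 * x * z)"
    unfolding xyz(2) by (simp add: xyz(1,3) power2_eq_square algebra_simps)
  \<comment> \<open>The equation is quadratic on the left and cubic on the right, so multiplying the
    entries by \<open>k\<close> leaves one factor \<open>k\<close> on the left.\<close>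
  have "k * ((u1 - u0 - u) ^ 2 - 4 * u0 * u) = - 4 * u0 * u1 * u"
  proof -
    have uw: "of_int u0 = of_int k * w0" "of_int u1 = of_int k * w1" "of_int u = of_int k * winf"
      unfolding kw using nz' by simp_all
    have "rat_of_int (k * ((u1 - u0 - u) ^ 2 - 4 * u0 * u)) = of_int k ^ 3 * Delta w0 w1 winf"
      by (simp add: uw Delta_def power2_eq_square power3_eq_cube algebra_simps)
    also have "Delta w0 w1 winf = - 4 * w0 * w1 * winf"
      using adm by (simp add: admissible_def)
    also have "of_int k ^ 3 * \<dots> = rat_of_int (- 4 * u0 * u1 * u)"
      by (simp add: uw power3_eq_cube)
    finally have "rat_of_int (k * ((u1 - u0 - u) ^ 2 - 4 * u0 * u)) = rat_of_int (- 4 * u0 * u1 * u)" .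
    then show ?thesis
      by (simp only: of_int_eq_iff)
  qed
  then have "k * (g ^ 2 * (y ^ 2 - 4 * x * z)) = - (2 * (2 * (u0 * (u1 * u))))"
    unfolding D by simp
  moreover have "- (2 * (2 * (u0 * (u1 * u)))) \<in> Pstar P"
    unfolding Pstar_uminus by (intro Pstar_mult Pstar_two two un')
  ultimately have "y ^ 2 - 4 * x * z \<in> Pstar P"
    by (metis Pstar_dvd dvd_triv_right)
  then have "disc s \<in> Pstar P"
    unfolding s using znz by (simp add: disc_quadratic mult_ac)
  moreover have "poly s 0 \<in> Pstar P" "poly s 1 \<in> Pstar P" "lead_coeff s \<in> Pstar P"
    using un'(1-3) znz unfolding u1 by (auto simp: s xyz add.assoc intro: Pstar_dvd)
  moreover have "lead_coeff s > 0"
  proof -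
    have "content s' > 0"
    proof -
      have "\<bar>content s'\<bar> = content s'"
        using normalize_content[of s'] unfolding normalize_int_def .
      moreover have "content s' \<noteq> 0"
        using \<open>s' \<noteq> 0\<close> by simp
      ultimately show ?thesis
        by linarith
    qed
    moreover have "content s' * z = \<bar>u\<bar>"
      using xyz(3) nz' by (auto simp: g_def sgn_if abs_if)
    ultimately have "z > 0"
      using nz' by (metis zero_less_abs_iff zero_less_mult_pos)
    then show ?thesis
      using znz by (simp add: s)
  qed
  moreover have "content s = 1"
    using nz' \<open>s' \<noteq> 0\<close> by (simp add: s_def sgn_if)
  ultimately have "s \<in> Polys2 P"
    using deg by (simp add: mem_Polys2_iff)
  moreover have "Spoly w0 w1 winf = smult (1 / of_int (lead_coeff s)) (map_poly of_int s)"
  proof -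
    \<comment> \<open>The coefficients of the unscaled quadratic are \<open>g / k\<close> times
      those of \<open>s\<close>, and this common factor cancels on division by
      \<open>winf\<close>.\<close>
    have "w0 / winf = of_int x / of_int z" "(w1 - w0 - winf) / winf = of_int y / of_int z" "winf \<noteq> 0"
    proof -
      have "winf = of_int g * of_int z / of_int k" "w0 = of_int g * of_int x / of_int k"
        by (simp_all add: kw xyz)
      moreover have "w1 - w0 - winf = of_int g * of_int y / of_int k"
        by (simp add: kw diff_divide_distrib[symmetric] xyz(2)[symmetric] flip: of_int_diff of_int_mult)
      ultimately show "w0 / winf = of_int x / of_int z" "(w1 - w0 - winf) / winf = of_int y / of_int z"
          "winf \<noteq> 0"
        using gnz znz nz' by simp_all
    qed
    then show ?thesis
      using znz by (simp add: s Spoly_def spoly_def map_poly_pCons)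
  qed
  ultimately show ?thesis
    unfolding MPolys2_def by blast
qed

text \<open>The scale \<open>l\<close> in \<open>(w0, w1, winf) = l * (s(0), s(1), s(\<infinity>))\<close> is forced by the
  equation: \<open>l\<^sup>2 * disc s = - 4 * l\<^sup>3 * s(0) * s(1) * s(\<infinity>)\<close>.\<close>

lemma MPolys2_Spoly:
  assumes two: "2 \<in> P" and "f \<in> MPolys2 P"
  shows "\<exists>\<delta> w0 w1 winf. f = Spoly w0 w1 winf \<and> admissible P \<delta> w0 w1 winf"
proof -
  obtain s where s: "s \<in> Polys2 P" and f: "f = smult (1 / of_int (lead_coeff s)) (map_poly of_int s)"
    using assms by (auto simp: MPolys2_def)
  have "degree s = 2"
    using s by (simp add: mem_Polys2_iff)
  then obtain c b a where seq: "s = [:c, b, a:]"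
    using degree_2_coeffs by blast
  with \<open>degree s = 2\<close> have "a \<noteq> 0"
    by (auto split: if_splits)
  define e D where "e = a + b + c" and "D = b ^ 2 - 4 * a * c"
  have un: "a \<in> Pstar P" "c \<in> Pstar P" "e \<in> Pstar P" "D \<in> Pstar P"
    using s \<open>a \<noteq> 0\<close> by (auto simp: mem_Polys2_iff seq disc_quadratic e_def D_def add_ac)
  note nz = un[THEN Pstar_nonzero]
  \<comment> \<open>The minus sign agrees with \<open>disc_Spoly_class\<close>: \<open>D\<close>
    must have class \<open>- \<delta>\<close>.\<close>
  define \<delta> where "\<delta> = - squarefree_part D"
  have \<delta>: "D = - \<delta> * square_part D ^ 2"
    unfolding \<delta>_def using squarefree_decompose[of D] by simp
  have "squarefree_part D dvd D"
    using squarefree_decompose[of D] by (metis dvd_triv_left)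
  then have "\<delta> \<in> Pstar P"
    unfolding \<delta>_def Pstar_uminus using un Pstar_dvd by blast
  moreover have "squarefree \<delta>"
    unfolding \<delta>_def by (metis squarefree_part_uminus squarefree_squarefree_part nz(4))
  moreover
  \<comment> \<open>These are \<open>l * c\<close>, \<open>l * e\<close>, \<open>l * a\<close> after
    cancellation, for the scale \<open>l\<close> defined below. The factor 4 is split into nested 2s
    so that \<open>Pstar_mult\<close> and \<open>Pstar_two\<close> apply to the
    denominators.\<close>
  define w0 w1 winf :: rat where "w0 = - of_int D / of_int (2 * (2 * (a * e)))"
    and "w1 = - of_int D / of_int (2 * (2 * (a * c)))"
    and "winf = - of_int D / of_int (2 * (2 * (c * e)))"
  have "w0 \<in> T_inf_2_inf_class P \<delta> \<union> {1}"
    unfolding w0_def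
    by (rule T_inf_2_inf_class_I[where y = "2 * a + b", OF _ _ _ \<delta>])
       (intro Pstar_mult Pstar_two two un | simp add: D_def e_def power2_eq_square algebra_simps)+
  moreover have "w1 \<in> T_inf_2_inf_class P \<delta> \<union> {1}"
    unfolding w1_def
    by (rule T_inf_2_inf_class_I[where y = "b", OF _ _ _ \<delta>])
       (intro Pstar_mult Pstar_two two un | simp add: D_def e_def power2_eq_square algebra_simps)+
  moreover have "winf \<in> T_inf_2_inf_class P \<delta> \<union> {1}"
    unfolding winf_def
    by (rule T_inf_2_inf_class_I[where y = "2 * c + b", OF _ _ _ \<delta>])
       (intro Pstar_mult Pstar_two two un | simp add: D_def e_def power2_eq_square algebra_simps)+
  moreover
  define l :: rat where "l = - of_int D / of_int (4 * a * c * e)"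
  have l: "w0 = l * of_int c" "w1 = l * of_int e" "winf = l * of_int a" "l \<noteq> 0"
    unfolding w0_def w1_def winf_def l_def using nz by simp_all
  have Dd: "Delta w0 w1 winf = l ^ 2 * of_int D"
    unfolding l Delta_def D_def e_def by (simp add: power2_eq_square algebra_simps)
  \<comment> \<open>Grouping the cubic side this way isolates
    \<open>l * (4 * a * c * e) = - D\<close>, which turns it into the value of
    \<open>Delta\<close>.\<close>
  have l3: "- 4 * w0 * w1 * winf = - (l * of_int (4 * a * c * e)) * l ^ 2"
    unfolding l by (simp add: power2_eq_square)
  have "l * of_int (4 * a * c * e) = - of_int D"
    unfolding l_def using nz by simp
  then have Dl: "- 4 * w0 * w1 * winf = l ^ 2 * of_int D"
    unfolding l3 by simp
  ultimately have "admissible P \<delta> w0 w1 winf"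
    unfolding admissible_def Dl Dd by simp
  moreover have "f = Spoly w0 w1 winf"
    unfolding f Spoly_def spoly_def l seq using nz l(4)
    by (simp add: map_poly_pCons e_def field_simps)
  ultimately show ?thesis
    by blast
qed

end

text \<open>The class is \<open>- \<delta>\<close> because \<open>disc_class\<close> uses
  \<open>w * (1 - w)\<close>; \<open>sign_example\<close> refutes the statement with \<delta> in its
  place.\<close>

theorem theorem4p1:
  fixes P :: "nat set"
  assumes "finite P" and "\<forall>p\<in>P. prime p" and "2 \<in> P"
  shows "(\<forall>\<delta> w0 w1 winf. admissible P \<delta> w0 w1 winf \<longrightarrow>
            sq_class (disc (Spoly w0 w1 winf)) = sq_class (of_int (- \<delta>))) \<and>
         {Spoly w0 w1 winf | \<delta> w0 w1 winf. admissible P \<delta> w0 w1 winf} = MPolys2 P"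
proof (intro conjI allI impI)
  show "sq_class (disc (Spoly w0 w1 winf)) = sq_class (of_int (- \<delta>))"
    if "admissible P \<delta> w0 w1 winf" for \<delta> w0 w1 winf
    using that by (rule disc_Spoly_class)
next
  show "{Spoly w0 w1 winf | \<delta> w0 w1 winf. admissible P \<delta> w0 w1 winf} = MPolys2 P"
  proof (rule subset_antisym; rule subsetI)
    fix f assume "f \<in> {Spoly w0 w1 winf | \<delta> w0 w1 winf. admissible P \<delta> w0 w1 winf}"
    then obtain \<delta> w0 w1 winf where "f = Spoly w0 w1 winf" "admissible P \<delta> w0 w1 winf"
      by blast
    then show "f \<in> MPolys2 P"
      using Spoly_in_MPolys2[OF assms] by simp
  next
    fix f assume "f \<in> MPolys2 P"
    from MPolys2_Spoly[OF assms this]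
    show "f \<in> {Spoly w0 w1 winf | \<delta> w0 w1 winf. admissible P \<delta> w0 w1 winf}"
      by (simp only: mem_Collect_eq)
  qed
qed

end
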